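(* Let $a<b$ be real numbers, $\alpha\in(0,1)$, and let $p,q,r$ be real-valued continuous functions on $[a,b]$ with $p(t)\neq0$ and $r(t)>0$ for all $t\in[a,b]$. Let $c_1,c_2,d_1,d_2\in\mathbb{R}$ with $c_1^2+c_2^2\neq0$ and $d_1^2+d_2^2\neq0$. Then every eigenvalue $\lambda\in\mathbb{C}$ of the fractional Sturm--Liouville problem $${}^{ABC}_{a}D^\alpha\big(p(t)\,{}^{ABR}D^\alpha_b x(t)\big)+q(t)x(t)=\lambda r(t)x(t),\qquad t\in(a,b),$$ $$c_1\,\mathbf{E}^1_{\alpha,1,\frac{-\alpha}{1-\alpha},b^-}x(a)+c_2\,{}^{ABR}D_b^\alpha x(a)=0,$$ $$d_1\,\mathbf{E}^1_{\alpha,1,\frac{-\alpha}{1-\alpha},b^-}x(b)+d_2\,{}^{ABR}D_b^\alpha x(b)=0,$$ is real.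
   Context: For $\alpha\in(0,1)$, $E_\alpha(z)=\sum_{k=0}^\infty \frac{z^k}{\Gamma(\alpha k+1)}$ is the Mittag-Leffler function, and $B(\alpha)>0$ is a normalization constant. For a (complex-valued) $f\in H^1(a,b)$, identified with its continuous representative on $[a,b]$, define $$\mathbf{E}^1_{\alpha,1,\frac{-\alpha}{1-\alpha},b^-}f(t)=\int_t^b E_\alpha\Big(\tfrac{-\alpha}{1-\alpha}(s-t)^\alpha\Big)f(s)\,ds,$$ the right ABR (Riemann--Liouville type) fractional derivative $${}^{ABR}D^\alpha_b f(t)=-\frac{B(\alpha)}{1-\alpha}\frac{d}{dt}\int_t^b f(s)E_\alpha\Big(\tfrac{-\alpha}{1-\alpha}(s-t)^\alpha\Big)ds$$ (one-sided derivatives at the endpoints of $[a,b]$), and the left ABC (Caputo type) fractional derivative $${}^{ABC}_{a}D^\alpha f(t)=\frac{B(\alpha)}{1-\alpha}\int_a^t f'(s)E_\alpha\Big(\tfrac{-\alpha}{1-\alpha}(t-s)^\alpha\Big)ds.$$ A solution of the problem is a complex-valued $x\in H^1(a,b)$ with $p\cdot{}^{ABR}D_b^\alpha x\in H^1(a,b)$ satisfying the equation and both boundary conditions. An eigenvalue is a $\lambda\in\mathbb{C}$ for which there is a nontrivial solution (one not identically zero), called an eigenfunction corresponding to $\lambda$. *)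

theory Defs
  imports "HOL-Analysis.Analysis"
begin

definition mittag_leffler :: "real \<Rightarrow> 'a \<Rightarrow> 'a::{real_normed_field, banach}" where
  "mittag_leffler \<alpha> z = (\<Sum>k. z ^ k / of_real (Gamma (\<alpha> * real k + 1)))"


text \<open>The Sobolev space \<open>H\<^sup>1(a,b)\<close> of complex-valued functions.  Its elements are represented
  by functions on the real line of which only the values on \<open>[a,b]\<close> matter.  The test functions
  are those of class \<open>C\<^sup>1\<close> with compact support in \<open>(a,b)\<close>, extended by zero; by mollification
  they determine the same weak derivatives as the smooth ones.\<close>

definition test_function :: "real \<Rightarrow> real \<Rightarrow> (real \<Rightarrow> real) \<Rightarrow> bool" where
  "test_function a b \<phi> \<longleftrightarrow> \<phi> C1_differentiable_on UNIV \<and>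
     (\<exists>K. compact K \<and> K \<subseteq> {a<..<b} \<and> (\<forall>t. t \<notin> K \<longrightarrow> \<phi> t = 0))"

definition square_integrable :: "real \<Rightarrow> real \<Rightarrow> (real \<Rightarrow> complex) \<Rightarrow> bool" where
  "square_integrable a b f \<longleftrightarrow> set_borel_measurable lborel {a<..<b} f \<and>
     set_integrable lborel {a<..<b} (\<lambda>t. (norm (f t))\<^sup>2)"

definition has_weak_deriv :: "real \<Rightarrow> real \<Rightarrow> (real \<Rightarrow> complex) \<Rightarrow> (real \<Rightarrow> complex) \<Rightarrow> bool" where
  "has_weak_deriv a b f g \<longleftrightarrow> square_integrable a b g \<and>
     (\<forall>\<phi>. test_function a b \<phi> \<longrightarrow>
        (LBINT t:{a<..<b}. deriv \<phi> t *\<^sub>R f t) = - (LBINT t:{a<..<b}. \<phi> t *\<^sub>R g t))"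

text \<open>Continuity on \<open>[a,b]\<close> selects the continuous representative.\<close>

definition H1 :: "real \<Rightarrow> real \<Rightarrow> (real \<Rightarrow> complex) set" where
  "H1 a b = {f. continuous_on {a..b} f \<and> square_integrable a b f \<and> (\<exists>g. has_weak_deriv a b f g)}"

text \<open>The weak derivative is unique up to a null set, so integrals against it do not depend
  on the choice.\<close>

definition weak_deriv :: "real \<Rightarrow> real \<Rightarrow> (real \<Rightarrow> complex) \<Rightarrow> real \<Rightarrow> complex" where
  "weak_deriv a b f = (SOME g. has_weak_deriv a b f g)"


text \<open>The operator \<open>E\<^sup>1\<close> with parameters \<open>\<alpha>, 1, \<omega>, b-\<close>.\<close>

definition mittag_leffler_integral_right ::
  "real \<Rightarrow> real \<Rightarrow> real \<Rightarrow> (real \<Rightarrow> complex) \<Rightarrow> real \<Rightarrow> complex" where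
  "mittag_leffler_integral_right \<alpha> \<omega> b f t =
     (LBINT s=ereal t..ereal b. mittag_leffler \<alpha> (\<omega> * (s - t) powr \<alpha>) *\<^sub>R f s)"

text \<open>Differentiation within \<open>[a,b]\<close> is one-sided at the endpoints; this is the only role of \<open>a\<close>.\<close>

definition ABR_right ::
  "(real \<Rightarrow> real) \<Rightarrow> real \<Rightarrow> real \<Rightarrow> real \<Rightarrow> (real \<Rightarrow> complex) \<Rightarrow> real \<Rightarrow> complex" where
  "ABR_right B \<alpha> a b f t =
     - (B \<alpha> / (1 - \<alpha>)) *\<^sub>R
       vector_derivative (mittag_leffler_integral_right \<alpha> (- \<alpha> / (1 - \<alpha>)) b f) (at t within {a..b})"

text \<open>Here \<open>b\<close> only fixes the interval on which the weak derivative is taken.\<close>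

definition ABC_left ::
  "(real \<Rightarrow> real) \<Rightarrow> real \<Rightarrow> real \<Rightarrow> real \<Rightarrow> (real \<Rightarrow> complex) \<Rightarrow> real \<Rightarrow> complex" where
  "ABC_left B \<alpha> a b f t =
     (B \<alpha> / (1 - \<alpha>)) *\<^sub>R
       (LBINT s=ereal a..ereal t.
          mittag_leffler \<alpha> (- \<alpha> / (1 - \<alpha>) * (t - s) powr \<alpha>) *\<^sub>R weak_deriv a b f s)"


definition SL_solution ::
  "(real \<Rightarrow> real) \<Rightarrow> real \<Rightarrow> real \<Rightarrow> real \<Rightarrow> (real \<Rightarrow> real) \<Rightarrow> (real \<Rightarrow> real) \<Rightarrow> (real \<Rightarrow> real) \<Rightarrow>
   real \<Rightarrow> real \<Rightarrow> real \<Rightarrow> real \<Rightarrow> complex \<Rightarrow> (real \<Rightarrow> complex) \<Rightarrow> bool" where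
  "SL_solution B \<alpha> a b p q r c1 c2 d1 d2 lam x \<longleftrightarrow>
     x \<in> H1 a b \<and>
     (\<lambda>t. p t *\<^sub>R ABR_right B \<alpha> a b x t) \<in> H1 a b \<and>
     (\<forall>t\<in>{a<..<b}.
        ABC_left B \<alpha> a b (\<lambda>s. p s *\<^sub>R ABR_right B \<alpha> a b x s) t + q t *\<^sub>R x t
          = lam * (r t *\<^sub>R x t)) \<and>
     c1 *\<^sub>R mittag_leffler_integral_right \<alpha> (- \<alpha> / (1 - \<alpha>)) b x a + c2 *\<^sub>R ABR_right B \<alpha> a b x a = 0 \<and>
     d1 *\<^sub>R mittag_leffler_integral_right \<alpha> (- \<alpha> / (1 - \<alpha>)) b x b + d2 *\<^sub>R ABR_right B \<alpha> a b x b = 0"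

definition SL_eigenvalue ::
  "(real \<Rightarrow> real) \<Rightarrow> real \<Rightarrow> real \<Rightarrow> real \<Rightarrow> (real \<Rightarrow> real) \<Rightarrow> (real \<Rightarrow> real) \<Rightarrow> (real \<Rightarrow> real) \<Rightarrow>
   real \<Rightarrow> real \<Rightarrow> real \<Rightarrow> real \<Rightarrow> complex \<Rightarrow> bool" where
  "SL_eigenvalue B \<alpha> a b p q r c1 c2 d1 d2 lam \<longleftrightarrow>
     (\<exists>x. SL_solution B \<alpha> a b p q r c1 c2 d1 d2 lam x \<and> (\<exists>t\<in>{a..b}. x t \<noteq> 0))"

end

theory Submission
  imports Defs
begin

text \<open>Multiplying the equation by the conjugate of an eigenfunction \<open>x\<close> and integrating moves the
  left Caputo type derivative onto \<open>x\<close>: Fubini's theorem on the triangle turns the left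
  convolution into the right one, and the remaining integration by parts produces
  \<open>\<integral> p |D x|\<^sup>2\<close> and boundary terms.  At \<open>b\<close> the integral operator vanishes, and at \<open>a\<close> the real
  boundary condition makes the term real.  Hence \<open>lam * \<integral> r |x|\<^sup>2\<close> is real, with a nonzero
  factor.  Functions in \<open>H\<^sup>1\<close> enter through the representation \<open>f t = f b - \<integral>\<^sub>t\<^sup>b f'\<close>, which
  follows from the du Bois-Reymond lemma and shows that the integral operator maps \<open>x\<close> to a
  continuously differentiable function.\<close>

section \<open>Integrals over bounded open intervals and Fubini's theorem on a triangle\<close>

lemma set_integrable_open_of_continuous_on:
  fixes f :: "real \<Rightarrow> 'a::euclidean_space"
  assumes "continuous_on {a..b} f"
  shows "set_integrable lborel {a<..<b} f"
  by (rule set_integrable_subset[OF borel_integrable_atLeastAtMost'[OF assms]]) auto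

text \<open>Both sides are iterated integrals of \<open>K (t - s) * g s * h t\<close> over the
  triangle \<open>a < s < t < b\<close>. There \<open>t - s\<close> stays in
  \<open>{0..b-a}\<close>, where \<open>K\<close> is bounded by some \<open>M\<close>, so
  \<open>M * norm (g s) * norm (h t)\<close> is a majorant on the product space.\<close>

lemma triangle_Fubini:
  fixes g h :: "real \<Rightarrow> complex" and K :: "real \<Rightarrow> real"
  assumes g: "set_integrable lborel {a<..<b} g" and h: "set_integrable lborel {a<..<b} h"
    and K: "continuous_on UNIV K"
  shows "(LBINT s:{a<..<b}. g s * (LBINT t:{s<..<b}. K (t - s) *\<^sub>R h t))
       = (LBINT t:{a<..<b}. (LBINT s:{a<..<t}. K (t - s) *\<^sub>R g s) * h t)"
proof -
  \<comment> \<open>Cutting \<open>g\<close> and \<open>h\<close> off outside the interval makes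
    both sides integrals over the whole plane; the factor for \<open>s < t\<close> in
    \<open>f\<close> selects the triangle.\<close>
  define G where "G s = indicator {a<..<b} s *\<^sub>R g s" for s
  define H where "H s = indicator {a<..<b} s *\<^sub>R h s" for s
  define f where "f s t = (indicator {(s, t). s < t} (s, t) * K (t - s)) *\<^sub>R (G s * H t)" for s t
  have G: "integrable lborel G" and H: "integrable lborel H"
    using g h unfolding set_integrable_def G_def H_def by simp_all
  have [measurable]: "G \<in> borel_measurable borel" "H \<in> borel_measurable borel"
    using borel_measurable_integrable[OF G] borel_measurable_integrable[OF H] by simp_all
  have [measurable]: "K \<in> borel_measurable borel"
    using K by (rule borel_measurable_continuous_onI)
  have "bounded (K ` {0..b-a})"
    using K by (meson compact_Icc compact_continuous_image compact_imp_bounded continuous_on_subset subset_UNIV)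
  then obtain M where M: "\<And>u. u \<in> {0..b-a} \<Longrightarrow> norm (K u) \<le> M"
    unfolding bounded_iff by blast
  have GH: "integrable (lborel \<Otimes>\<^sub>M lborel) (\<lambda>(s, t). G s * H t)"
  proof (rule lborel_pair.Fubini_integrable)
    show "(\<lambda>(s, t). G s * H t) \<in> borel_measurable (lborel \<Otimes>\<^sub>M lborel)"
      by measurable
    show "integrable lborel (\<lambda>s. \<integral>t. norm (case (s, t) of (s, t) \<Rightarrow> G s * H t) \<partial>lborel)"
      using G by (simp add: norm_mult)
    show "AE s in lborel. integrable lborel (\<lambda>t. case (s, t) of (s, t) \<Rightarrow> G s * H t)"
      using H by simp
  qed
  have f: "integrable (lborel \<Otimes>\<^sub>M lborel) (case_prod f)"
  proof (rule Bochner_Integration.integrable_bound)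
    show "integrable (lborel \<Otimes>\<^sub>M lborel) (\<lambda>z. M *\<^sub>R (case z of (s, t) \<Rightarrow> G s * H t))"
      using GH by (rule integrable_scaleR_right)
    have [measurable]: "{(s, t). s < (t::real)} \<in> sets (borel \<Otimes>\<^sub>M borel)"
    proof -
      have "{(s, t). s < (t::real)} = {z \<in> space (borel \<Otimes>\<^sub>M borel). fst z < snd z}"
        by (auto simp: space_pair_measure)
      also have "\<dots> \<in> sets (borel \<Otimes>\<^sub>M borel)"
        by measurable
      finally show ?thesis .
    qed
    show "case_prod f \<in> borel_measurable (lborel \<Otimes>\<^sub>M lborel)"
      unfolding f_def by measurable
    have "norm (case_prod f z) \<le> norm (M *\<^sub>R (case z of (s, t) \<Rightarrow> G s * H t))" for z
    proof (cases z)
      case (Pair s t)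
      show ?thesis
      proof (cases "a < s \<and> s < t \<and> t < b")
        case True
        then have "\<bar>K (t - s)\<bar> * norm (G s * H t) \<le> \<bar>M\<bar> * norm (G s * H t)"
          using M[of "t - s"] by (intro mult_right_mono) auto
        then show ?thesis
          using True by (simp add: Pair f_def)
      next
        case False
        then have "f s t = 0"
          by (auto simp: f_def G_def H_def indicator_def)
        then show ?thesis
          by (simp add: Pair)
      qed
    qed
    then show "AE z in lborel \<Otimes>\<^sub>M lborel. norm (case_prod f z) \<le> norm (M *\<^sub>R (case z of (s, t) \<Rightarrow> G s * H t))"
      by simp
  qed
  have "(LBINT s:{a<..<b}. g s * (LBINT t:{s<..<b}. K (t - s) *\<^sub>R h t)) = (\<integral>s. (\<integral>t. f s t \<partial>lborel) \<partial>lborel)"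
    unfolding set_lebesgue_integral_def
  proof (rule Bochner_Integration.integral_cong[OF refl])
    fix s
    \<comment> \<open>The factor \<open>g s\<close> is constant in \<open>t\<close> and passes under
      the integral without an integrability check on the slice, since a non-integrable function has
      integral 0.\<close>
    have "indicator {a<..<b} s *\<^sub>R (g s * (\<integral>t. indicator {s<..<b} t *\<^sub>R K (t - s) *\<^sub>R h t \<partial>lborel))
        = (\<integral>t. (indicator {a<..<b} s *\<^sub>R g s) * (indicator {s<..<b} t *\<^sub>R K (t - s) *\<^sub>R h t) \<partial>lborel)"
      by (simp only: integral_mult_right_zero mult_scaleR_left integral_scaleR_right)
    also have "\<dots> = (\<integral>t. f s t \<partial>lborel)"
      by (rule Bochner_Integration.integral_cong[OF refl]) (auto simp: f_def G_def H_def indicator_def)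
    finally show "indicator {a<..<b} s *\<^sub>R (g s * (\<integral>t. indicator {s<..<b} t *\<^sub>R K (t - s) *\<^sub>R h t \<partial>lborel))
        = (\<integral>t. f s t \<partial>lborel)" .
  qed
  also have "\<dots> = (\<integral>t. (\<integral>s. f s t \<partial>lborel) \<partial>lborel)"
    using lborel_pair.Fubini_integral[OF f] by simp
  also have "\<dots> = (LBINT t:{a<..<b}. (LBINT s:{a<..<t}. K (t - s) *\<^sub>R g s) * h t)"
    unfolding set_lebesgue_integral_def
  proof (rule Bochner_Integration.integral_cong[OF refl])
    fix t
    have "indicator {a<..<b} t *\<^sub>R ((\<integral>s. indicator {a<..<t} s *\<^sub>R K (t - s) *\<^sub>R g s \<partial>lborel) * h t)
        = (\<integral>s. (indicator {a<..<t} s *\<^sub>R K (t - s) *\<^sub>R g s) * (indicator {a<..<b} t *\<^sub>R h t) \<partial>lborel)"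
      by (simp only: integral_mult_left_zero mult_scaleR_right integral_scaleR_right)
    also have "\<dots> = (\<integral>s. f s t \<partial>lborel)"
      by (rule Bochner_Integration.integral_cong[OF refl]) (auto simp: f_def G_def H_def indicator_def)
    finally show "(\<integral>s. f s t \<partial>lborel)
      = indicator {a<..<b} t *\<^sub>R ((\<integral>s. indicator {a<..<t} s *\<^sub>R K (t - s) *\<^sub>R g s \<partial>lborel) * h t)" ..
  qed
  finally show ?thesis .
qed

text \<open>With kernel 1 the inner integrals are primitives of \<open>h\<close> and
  \<open>g\<close>, so this is integration by parts for functions that are merely
  integrable.\<close>

lemma triangle_Fubini_unit:
  fixes g h :: "real \<Rightarrow> complex"
  assumes "set_integrable lborel {a<..<b} g" and "set_integrable lborel {a<..<b} h"
  shows "(LBINT s:{a<..<b}. g s * (LBINT t:{s<..<b}. h t)) = (LBINT t:{a<..<b}. (LBINT s:{a<..<t}. g s) * h t)"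
  using triangle_Fubini[OF assms, of "\<lambda>_. 1"] by simp

lemma tail_integral_has_vector_derivative:
  fixes f :: "real \<Rightarrow> complex"
  assumes f: "continuous_on {a..b} f" and t: "t \<in> {a..b}"
  shows "((\<lambda>t. LBINT s:{t<..<b}. f s) has_vector_derivative - f t) (at t within {a..b})"
proof -
  have "((\<lambda>u. LBINT y=b..u. f y) has_vector_derivative f t) (at t within {a..b})"
    using t by (intro interval_integral_FTC2 f) auto
  then have "((\<lambda>u. - (LBINT y=b..u. f y)) has_vector_derivative - f t) (at t within {a..b})"
    by (rule has_vector_derivative_minus)
  then show ?thesis
  proof (rule has_vector_derivative_transform[OF t, rotated])
    fix u assume "u \<in> {a..b}"
    then show "(LBINT s:{u<..<b}. f s) = - (LBINT y=b..u. f y)"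
      by (subst interval_integral_endpoints_reverse) (simp add: interval_lebesgue_integral_le_eq)
  qed
qed

lemma set_integral_FTC:
  fixes F f :: "real \<Rightarrow> complex"
  assumes "a \<le> b" and "\<And>t. t \<in> {a..b} \<Longrightarrow> (F has_vector_derivative f t) (at t within {a..b})"
    and "continuous_on {a..b} f"
  shows "(LBINT t:{a<..<b}. f t) = F b - F a"
proof -
  have "(LBINT t=a..b. f t) = F b - F a"
    using assms by (intro interval_integral_FTC_finite) auto
  then show ?thesis
    using assms(1) by (simp add: interval_lebesgue_integral_le_eq)
qed

lemma set_integral_open_eq_integral:
  fixes f :: "real \<Rightarrow> real"
  assumes "a \<le> b" "continuous_on {a..b} f"
  shows "(LBINT t:{a<..<b}. f t) = integral {a..b} f"
  using interval_integral_eq_integral[OF assms(1) borel_integrable_atLeastAtMost'[OF assms(2)]] assms(1)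
  by (simp add: interval_lebesgue_integral_le_eq)

lemma set_integral_split_point:
  fixes f :: "real \<Rightarrow> complex"
  assumes "set_integrable lborel {a<..<b} f" "a \<le> t" "t \<le> b"
  shows "(LBINT s:{a<..<b}. f s) = (LBINT s:{a<..<t}. f s) + (LBINT s:{t<..<b}. f s)"
proof -
  have "interval_lebesgue_integrable lborel (min (ereal a) (min (ereal t) (ereal b)))
      (max (ereal a) (max (ereal t) (ereal b))) f"
    using assms by (simp add: interval_lebesgue_integrable_def min_def max_def)
  then have "(LBINT s=a..t. f s) + (LBINT s=t..b. f s) = (LBINT s=a..b. f s)"
    by (rule interval_integral_sum)
  then show ?thesis
    using assms by (simp add: interval_lebesgue_integral_le_eq)
qed

text \<open>Dominated convergence along sequences: a bound \<open>M\<close> of \<open>K\<close> on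
  \<open>{0..b-a}\<close> gives the majorant \<open>M * norm (g s)\<close>, and moving the lower
  limit into an indicator fixes the domain of integration.\<close>

lemma continuous_on_tail_convolution:
  fixes K :: "real \<Rightarrow> real" and g :: "real \<Rightarrow> complex"
  assumes K: "continuous_on UNIV K" and g: "set_integrable lborel {a<..<b} g"
  shows "continuous_on {a..b} (\<lambda>t. LBINT s:{t<..<b}. K (s - t) *\<^sub>R g s)"
proof -
  define G where "G s = indicator {a<..<b} s *\<^sub>R g s" for s
  define f where "f t s = (indicator {t<..<b} s * K (s - t)) *\<^sub>R G s" for t s
  have G: "integrable lborel G"
    using g unfolding set_integrable_def G_def .
  have [measurable]: "G \<in> borel_measurable borel"
    using borel_measurable_integrable[OF G] by simp
  have [measurable]: "K \<in> borel_measurable borel"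
    using K by (rule borel_measurable_continuous_onI)
  have "bounded (K ` {0..b-a})"
    using K by (meson compact_Icc compact_continuous_image compact_imp_bounded continuous_on_subset subset_UNIV)
  then obtain M where M: "\<And>u. u \<in> {0..b-a} \<Longrightarrow> norm (K u) \<le> M"
    unfolding bounded_iff by blast
  have eq: "(LBINT s:{t<..<b}. K (s - t) *\<^sub>R g s) = (\<integral>s. f t s \<partial>lborel)" if "t \<in> {a..b}" for t
    unfolding set_lebesgue_integral_def using that
    by (intro Bochner_Integration.integral_cong[OF refl]) (auto simp: f_def G_def indicator_def)
  have bound: "norm (f t s) \<le> norm (M *\<^sub>R G s)" if "t \<in> {a..b}" for t s
  proof (cases "t < s \<and> s < b")
    case True
    then have "\<bar>K (s - t)\<bar> * norm (G s) \<le> \<bar>M\<bar> * norm (G s)"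
      using M[of "s - t"] that by (intro mult_right_mono) auto
    then show ?thesis
      using True by (simp add: f_def)
  qed (simp add: f_def)
  have "continuous_on {a..b} (\<lambda>t. \<integral>s. f t s \<partial>lborel)"
    unfolding continuous_on_sequentially comp_def
  proof (intro allI ballI impI, elim conjE)
    fix T t assume t: "t \<in> {a..b}" and T: "\<forall>n. T n \<in> {a..b}" "T \<longlonglongrightarrow> t"
    show "(\<lambda>n. \<integral>s. f (T n) s \<partial>lborel) \<longlonglongrightarrow> (\<integral>s. f t s \<partial>lborel)"
    proof (rule integral_dominated_convergence[where w = "\<lambda>s. norm (M *\<^sub>R G s)"])
      show "f t \<in> borel_measurable lborel" "\<And>n. f (T n) \<in> borel_measurable lborel"
        unfolding f_def by measurable
      show "integrable lborel (\<lambda>s. norm (M *\<^sub>R G s))"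
        using G by simp
      show "AE s in lborel. norm (f (T n) s) \<le> norm (M *\<^sub>R G s)" for n
        using bound[of "T n"] T(1) by simp
      \<comment> \<open>The point \<open>s = t\<close> is excluded because the indicators need not
        converge there: \<open>T n\<close> may approach \<open>t\<close> from either side.\<close>
      show "AE s in lborel. (\<lambda>n. f (T n) s) \<longlonglongrightarrow> f t s"
        using AE_lborel_singleton[of t]
      proof eventually_elim
        case (elim s)
        have "(\<lambda>n. indicator {T n<..<b} s :: real) \<longlonglongrightarrow> indicator {t<..<b} s"
        proof (cases "t < s")
          case True
          with T(2) have "\<forall>\<^sub>F n in sequentially. T n < s"
            by (rule order_tendstoD)
          then have "\<forall>\<^sub>F n in sequentially. indicator {t<..<b} s = (indicator {T n<..<b} s :: real)"
            by eventually_elim (use True in \<open>auto simp: indicator_def\<close>)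
          then show ?thesis
            by (rule Lim_transform_eventually[OF tendsto_const])
        next
          case False
          with elim have st: "s < t" by simp
          with T(2) have "\<forall>\<^sub>F n in sequentially. s < T n"
            by (rule order_tendstoD)
          then have "\<forall>\<^sub>F n in sequentially. indicator {t<..<b} s = (indicator {T n<..<b} s :: real)"
            by eventually_elim (use st in \<open>auto simp: indicator_def\<close>)
          then show ?thesis
            by (rule Lim_transform_eventually[OF tendsto_const])
        qed
        moreover have "(\<lambda>n. K (s - T n)) \<longlonglongrightarrow> K (s - t)"
          using K T(2) by (intro continuous_on_tendsto_compose[OF K]) (auto intro!: tendsto_intros)
        ultimately show ?case
          unfolding f_def by (intro tendsto_intros)
      qed
    qed
  qed
  then show ?thesis
    by (rule continuous_on_eq) (simp add: eq)
qed

section \<open>Growth of the Gamma function and continuity of the Mittag-Leffler kernel\<close>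

text \<open>In Euler's integral the part below \<open>T\<close> is dropped, and beyond
  \<open>T\<close> the power \<open>t powr (x - 1)\<close> is at least its value at
  \<open>T\<close>; the integral of \<open>exp (- t)\<close> from \<open>T\<close> on is
  \<open>exp (- T)\<close>. Since \<open>T\<close> is free, Gamma outgrows every geometric
  sequence.\<close>

lemma Gamma_ge_powr_exp:
  fixes x T :: real
  assumes "1 \<le> x" and "0 < T"
  shows "T powr (x - 1) * exp (- T) \<le> Gamma x"
proof -
  have "((\<lambda>t. exp (- 1 * t)) has_integral exp (- 1 * T) / 1) {T..}"
    by (rule has_integral_exp_minus_to_infinity) simp
  from has_integral_mult_right[OF this, of "T powr (x - 1)"]
  have 1: "((\<lambda>t. T powr (x - 1) * exp (- t)) has_integral T powr (x - 1) * exp (- T)) {T..}"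
    by simp
  have 2: "((\<lambda>t. t powr (x - 1) / exp t) has_integral Gamma x) {0..}"
    using assms by (intro Gamma_integral_real) simp
  have 3: "((\<lambda>t. if t \<in> {T..} then T powr (x - 1) * exp (- t) else 0) has_integral T powr (x - 1) * exp (- T)) {0..}"
    using 1 assms by (subst has_integral_restrict) auto
  show ?thesis
  proof (rule has_integral_le[OF 3 2])
    fix t :: real assume "t \<in> {0..}"
    show "(if t \<in> {T..} then T powr (x - 1) * exp (- t) else 0) \<le> t powr (x - 1) / exp t"
    proof (cases "T \<le> t")
      case True
      then have "T powr (x - 1) \<le> t powr (x - 1)"
        using assms by (intro powr_mono2) auto
      then have "T powr (x - 1) * exp (- t) \<le> t powr (x - 1) * exp (- t)"
        by (rule mult_right_mono) simp
      with True show ?thesis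
        by (simp add: exp_minus divide_inverse)
    qed simp
  qed
qed

lemma mittag_leffler_summable:
  fixes \<alpha> z :: real
  assumes "0 < \<alpha>"
  shows "summable (\<lambda>k. inverse (Gamma (\<alpha> * real k + 1)) * z ^ k)"
proof -
  \<comment> \<open>As \<open>T powr \<alpha> > 2 * \<bar>z\<bar>\<close>, the lower bound on \<open>Gamma\<close> gives a geometric majorant.\<close>
  define T where "T = (2 * \<bar>z\<bar> + 1) powr (1 / \<alpha>)"
  have T: "0 < T" "T powr \<alpha> = 2 * \<bar>z\<bar> + 1"
    using assms by (simp_all add: T_def powr_powr)
  have "summable (\<lambda>k. exp T * (\<bar>z\<bar> / (2 * \<bar>z\<bar> + 1)) ^ k)"
    by (intro summable_mult summable_geometric) (simp add: field_simps abs_if)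
  then show ?thesis
  proof (rule summable_comparison_test'[where N = 0])
    fix k :: nat
    have "T powr (\<alpha> * real k) = (2 * \<bar>z\<bar> + 1) ^ k"
      using T by (simp add: powr_powr[symmetric] powr_realpow)
    then have G: "(2 * \<bar>z\<bar> + 1) ^ k * exp (- T) \<le> Gamma (\<alpha> * real k + 1)"
      using Gamma_ge_powr_exp[of "\<alpha> * real k + 1" T] assms T by simp
    have pos: "0 < (2 * \<bar>z\<bar> + 1) ^ k * exp (- T)" by simp
    have "inverse (Gamma (\<alpha> * real k + 1)) \<le> inverse ((2 * \<bar>z\<bar> + 1) ^ k * exp (- T))"
      using G pos by (rule le_imp_inverse_le)
    then have "inverse (Gamma (\<alpha> * real k + 1)) * \<bar>z\<bar> ^ k \<le> inverse ((2 * \<bar>z\<bar> + 1) ^ k * exp (- T)) * \<bar>z\<bar> ^ k"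
      by (rule mult_right_mono) simp
    also have "\<dots> = exp T * (\<bar>z\<bar> / (2 * \<bar>z\<bar> + 1)) ^ k"
      by (simp add: exp_minus power_divide field_simps)
    finally have "inverse (Gamma (\<alpha> * real k + 1)) * \<bar>z\<bar> ^ k \<le> exp T * (\<bar>z\<bar> / (2 * \<bar>z\<bar> + 1)) ^ k" .
    moreover have "0 < Gamma (\<alpha> * real k + 1)"
      using pos G by (rule less_le_trans)
    ultimately show "norm (inverse (Gamma (\<alpha> * real k + 1)) * z ^ k) \<le> exp T * (\<bar>z\<bar> / (2 * \<bar>z\<bar> + 1)) ^ k"
      by (simp add: abs_mult power_abs)
  qed
qed

lemma continuous_on_mittag_leffler:
  assumes "0 < \<alpha>"
  shows "continuous_on UNIV (mittag_leffler \<alpha> :: real \<Rightarrow> real)"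
proof -
  have "isCont (\<lambda>z. \<Sum>k. inverse (Gamma (\<alpha> * real k + 1)) * z ^ k) x" for x :: real
    using mittag_leffler_summable[OF assms] by (rule isCont_powser_converges_everywhere)
  moreover have "(mittag_leffler \<alpha> :: real \<Rightarrow> real) = (\<lambda>z. \<Sum>k. inverse (Gamma (\<alpha> * real k + 1)) * z ^ k)"
    by (simp add: fun_eq_iff mittag_leffler_def divide_inverse mult.commute)
  ultimately show ?thesis
    by (simp add: continuous_at_imp_continuous_on)
qed

text \<open>The convolution lemmas ask for a kernel continuous on the whole line, although their
  integrals evaluate it at nonnegative arguments. Taking \<open>max u 0\<close> extends it by a
  constant to the left, and \<open>0 < \<alpha>\<close> gives continuity at 0.\<close>

lemma continuous_on_mittag_leffler_kernel:
  assumes "0 < \<alpha>"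
  shows "continuous_on UNIV (\<lambda>u. mittag_leffler \<alpha> (w * max u 0 powr \<alpha>) :: real)"
  by (rule continuous_on_compose2[OF continuous_on_mittag_leffler[OF assms]])
    (use assms in \<open>auto intro!: continuous_intros continuous_on_powr'\<close>)

section \<open>The du Bois-Reymond lemma\<close>

text \<open>Any two interior points are compared by means of a test function built for that pair;
  continuity carries the common value to the endpoints.\<close>

lemma du_Bois_Reymond:
  fixes u :: "real \<Rightarrow> real"
  assumes ab: "a < b" and u: "continuous_on {a..b} u"
    and orth: "\<And>\<phi>. test_function a b \<phi> \<Longrightarrow> (LBINT t:{a<..<b}. deriv \<phi> t * u t) = 0"
    and t: "t \<in> {a..b}"
  shows "u t = u b"
proof -
  have inner: "u s = u t" if "s \<in> {a<..<b}" "t \<in> {a<..<b}" for s t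
  proof -
    \<comment> \<open>The interval \<open>{l..m}\<close> contains both points in its interior and
      lies inside \<open>{a<..<b}\<close>; it becomes the compact support of the test
      function.\<close>
    obtain l where l: "a < l" "l < min s t"
      using dense[of a "min s t"] \<open>s \<in> _\<close> \<open>t \<in> _\<close> by auto
    obtain m where m: "max s t < m" "m < b"
      using dense[of "max s t" b] \<open>s \<in> _\<close> \<open>t \<in> _\<close> by auto
    \<comment> \<open>A continuous bump, positive exactly between \<open>l\<close> and
      \<open>m\<close>, hence at \<open>s\<close> and \<open>t\<close>. The function
      \<open>v\<close> continues \<open>u\<close> by its endpoint values, so that products with it
      are continuous on the whole line, as a test function of class C1 on \<open>UNIV\<close>
      requires.\<close>
    define \<eta> where "\<eta> \<tau> = max 0 (\<tau> - l) * max 0 (m - \<tau>)" for \<tau> :: real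
    define v where "v \<tau> = u (max a (min b \<tau>))" for \<tau>
    have \<eta>: "continuous_on S \<eta>" for S
      unfolding \<eta>_def by (intro continuous_intros)
    have v: "continuous_on S v" for S
      unfolding v_def
      by (rule continuous_on_compose2[OF u]) (use ab in \<open>auto intro!: continuous_intros\<close>)
    have \<eta>_nonneg: "0 \<le> \<eta> \<tau>" for \<tau>
      by (simp add: \<eta>_def)
    have \<eta>_out: "\<eta> \<tau> = 0" if "\<tau> \<le> l \<or> m \<le> \<tau>" for \<tau>
      using that by (auto simp: \<eta>_def)
    have \<eta>_in: "\<eta> s > 0" "\<eta> t > 0"
      using l m by (simp_all add: \<eta>_def)
    have N: "integral {a..b} \<eta> \<noteq> 0"
      using integral_eq_0_iff[OF \<eta> ab \<eta>_nonneg] \<eta>_in \<open>s \<in> _\<close> by force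
    \<comment> \<open>With \<open>c\<close> the \<open>\<eta>\<close>-weighted mean of \<open>u\<close>, the primitive of \<open>\<eta> * (u - c)\<close> is a test function,
      and testing with it gives \<open>\<integral> \<eta> * (u - c)\<^sup>2 = 0\<close>.\<close>
    define c where "c = integral {a..b} (\<lambda>\<tau>. \<eta> \<tau> * v \<tau>) / integral {a..b} \<eta>"
    define \<psi> where "\<psi> \<tau> = \<eta> \<tau> * (v \<tau> - c)" for \<tau>
    have \<psi>: "continuous_on S \<psi>" for S
      unfolding \<psi>_def by (intro continuous_intros \<eta> v)
    have int: "(\<lambda>\<tau>. \<eta> \<tau> * v \<tau>) integrable_on {a..b}" "\<eta> integrable_on {a..b}" "\<psi> integrable_on {a..b}"
      by (intro integrable_continuous_real continuous_intros \<eta> v \<psi>)+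
    have "integral {a..b} \<psi> = integral {a..b} (\<lambda>\<tau>. \<eta> \<tau> * v \<tau> - \<eta> \<tau> * c)"
      by (rule Henstock_Kurzweil_Integration.integral_cong) (simp add: \<psi>_def algebra_simps)
    also have "\<dots> = integral {a..b} (\<lambda>\<tau>. \<eta> \<tau> * v \<tau>) - integral {a..b} (\<lambda>\<tau>. \<eta> \<tau> * c)"
      using int by (intro Henstock_Kurzweil_Integration.integral_diff integrable_on_mult_left) auto
    also have "\<dots> = 0"
      using N by (simp add: c_def)
    finally have mean: "integral {a..b} \<psi> = 0" .
    have "\<exists>F. \<forall>\<tau>::real. -\<infinity> < ereal \<tau> \<longrightarrow> ereal \<tau> < \<infinity> \<longrightarrow> (F has_vector_derivative \<psi> \<tau>) (at \<tau>)"
      using \<psi>[of UNIV] by (intro einterval_antiderivative) (auto simp: continuous_on_eq_continuous_at)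
    then obtain F where F: "\<And>\<tau>. (F has_vector_derivative \<psi> \<tau>) (at \<tau>)"
      by auto
    define \<phi> where "\<phi> \<tau> = F \<tau> - F a" for \<tau>
    have \<phi>: "(\<phi> has_vector_derivative \<psi> \<tau>) (at \<tau> within S)" for \<tau> S
      unfolding \<phi>_def using has_vector_derivative_diff_const[of F "F a" "\<psi> \<tau>"] F[of \<tau>]
      by (simp add: has_vector_derivative_at_within)
    have "(\<psi> has_integral \<phi> b - \<phi> a) {a..b}"
      using ab \<phi> by (intro fundamental_theorem_of_calculus) auto
    then have \<phi>b: "\<phi> b = 0"
      using mean by (simp add: \<phi>_def integral_unique)
    have out1: "\<phi> \<tau> = 0" if "\<tau> \<le> l" for \<tau>
    proof -
      have "(\<phi> has_vector_derivative 0) (at x within {..l})" if "x \<in> {..l}" for x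
        using \<phi>[of x "{..l}"] \<eta>_out[of x] that by (simp add: \<psi>_def)
      then obtain d where "\<And>x. x \<in> {..l} \<Longrightarrow> \<phi> x = d"
        using has_vector_derivative_zero_constant[of "{..l}" \<phi>] by (auto simp: convex_real_interval)
      then show ?thesis
        using that l by (metis atMost_iff less_imp_le diff_self \<phi>_def)
    qed
    \<comment> \<open>To the right of \<open>m\<close> the primitive is constant, and its value
      there is \<open>\<phi> b\<close>, which vanishes because \<open>\<psi>\<close> has integral
      zero.\<close>
    have out2: "\<phi> \<tau> = 0" if "m \<le> \<tau>" for \<tau>
    proof -
      have "(\<phi> has_vector_derivative 0) (at x within {m..})" if "x \<in> {m..}" for x
        using \<phi>[of x "{m..}"] \<eta>_out[of x] that by (simp add: \<psi>_def)
      then obtain d where "\<And>x. x \<in> {m..} \<Longrightarrow> \<phi> x = d"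
        using has_vector_derivative_zero_constant[of "{m..}" \<phi>] by (auto simp: convex_real_interval)
      then show ?thesis
        using that m \<phi>b by (metis atLeast_iff less_imp_le)
    qed
    have test: "test_function a b \<phi>"
      unfolding test_function_def C1_differentiable_on_def
      using \<phi> \<psi> l m out1 out2
      by (intro conjI exI[of _ \<psi>] exI[of _ "{l..m}"]) (auto simp: not_le)
    have "(LBINT \<tau>:{a<..<b}. \<psi> \<tau> * v \<tau>) = 0"
    proof -
      have "deriv \<phi> \<tau> = \<psi> \<tau>" for \<tau>
        using \<phi>[of \<tau> UNIV] by (intro DERIV_imp_deriv) (simp add: has_real_derivative_iff_has_vector_derivative)
      moreover have "v \<tau> = u \<tau>" if "\<tau> \<in> {a<..<b}" for \<tau>
        using that by (simp add: v_def)
      ultimately have "(LBINT \<tau>:{a<..<b}. \<psi> \<tau> * v \<tau>) = (LBINT \<tau>:{a<..<b}. deriv \<phi> \<tau> * u \<tau>)"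
        by (intro set_lebesgue_integral_cong) auto
      then show ?thesis
        using orth[OF test] by simp
    qed
    then have "integral {a..b} (\<lambda>\<tau>. \<psi> \<tau> * v \<tau>) = 0"
      using ab set_integral_open_eq_integral[of a b "\<lambda>\<tau>. \<psi> \<tau> * v \<tau>"] continuous_on_mult[OF \<psi> v]
      by simp
    \<comment> \<open>Subtracting \<open>c * \<psi>\<close> does not change the integral, again
      because \<open>\<psi>\<close> has integral zero, and it completes the square.\<close>
    moreover have "integral {a..b} (\<lambda>\<tau>. \<psi> \<tau> * v \<tau> - \<psi> \<tau> * c)
        = integral {a..b} (\<lambda>\<tau>. \<psi> \<tau> * v \<tau>) - integral {a..b} (\<lambda>\<tau>. \<psi> \<tau> * c)"
      by (intro Henstock_Kurzweil_Integration.integral_diff integrable_continuous_real continuous_intros \<psi> v)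
    moreover have "\<psi> \<tau> * v \<tau> - \<psi> \<tau> * c = \<eta> \<tau> * (v \<tau> - c)\<^sup>2" for \<tau>
      by (simp add: \<psi>_def power2_eq_square algebra_simps)
    ultimately have "integral {a..b} (\<lambda>\<tau>. \<eta> \<tau> * (v \<tau> - c)\<^sup>2) = 0"
      using mean by simp
    moreover have "continuous_on {a..b} (\<lambda>\<tau>. \<eta> \<tau> * (v \<tau> - c)\<^sup>2)"
      by (intro continuous_intros \<eta> v)
    ultimately have zero: "\<eta> \<tau> * (v \<tau> - c)\<^sup>2 = 0" if "\<tau> \<in> {a..b}" for \<tau>
      using integral_eq_0_iff[of a b "\<lambda>\<tau>. \<eta> \<tau> * (v \<tau> - c)\<^sup>2"] ab \<eta>_nonneg that by simp
    have "v s = c" "v t = c"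
      using zero[of s] zero[of t] \<eta>_in \<open>s \<in> _\<close> \<open>t \<in> _\<close> by simp_all
    then show ?thesis
      using \<open>s \<in> _\<close> \<open>t \<in> _\<close> by (simp add: v_def)
  qed
  have const: "u x = u ((a + b) / 2)" if "x \<in> {a..b}" for x
  proof (rule continuous_constant_on_closure[where S = "{a<..<b}" and f = u])
    show "u y = u ((a + b) / 2)" if "y \<in> {a<..<b}" for y
      using ab that by (intro inner) auto
  qed (use u ab that in simp_all)
  show ?thesis
    using const[OF t] const[of b] ab by simp
qed

section \<open>Representation of functions in \<open>H1\<close> as tail integrals of their weak
  derivatives\<close>

lemma square_integrable_imp_set_integrable:
  assumes "square_integrable a b f"
  shows "set_integrable lborel {a<..<b} f"
proof -
  have "set_integrable lborel {a<..<b} (\<lambda>t. 1 + (norm (f t))\<^sup>2)"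
    using assms by (intro set_integral_add) (auto simp: square_integrable_def intro: set_integrable_open_of_continuous_on)
  then show ?thesis
    using assms unfolding square_integrable_def
  proof (elim set_integrable_bound conjE)
    have "norm (f t) \<le> 1 + (norm (f t))\<^sup>2" for t
      using sum_squares_bound[of 1 "norm (f t)"] norm_ge_zero[of "f t"] by (simp only: power_one mult_1_right)
    then show "AE t in lborel. t \<in> {a<..<b} \<longrightarrow> norm (f t) \<le> norm (1 + (norm (f t))\<^sup>2)"
      by (simp add: add_nonneg_nonneg)
  qed
qed

lemma set_integral_cnj: "(LBINT t:A. cnj (f t)) = cnj (LBINT t:A. f t)"
  unfolding set_lebesgue_integral_def by (simp flip: complex_cnj_scaleR)

text \<open>The substitution swapping the endpoints; it turns a kernel \<open>K (s - t)\<close> on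
  \<open>{t<..<v}\<close> into \<open>K (v - s)\<close>.\<close>

lemma set_integral_reflect:
  fixes f :: "real \<Rightarrow> complex"
  shows "(LBINT s:{t<..<v}. f s) = (LBINT s:{t<..<v}. f (t + v - s))"
proof -
  have "(LBINT s:{t<..<v}. f s) = (\<integral>s. indicator {t<..<v} ((t + v) + (-1) * s) *\<^sub>R f ((t + v) + (-1) * s) \<partial>lborel)"
    unfolding set_lebesgue_integral_def
    using lborel_integral_real_affine[of "-1" "\<lambda>s. indicator {t<..<v} s *\<^sub>R f s" "t + v"] by simp
  also have "\<dots> = (LBINT s:{t<..<v}. f (t + v - s))"
    unfolding set_lebesgue_integral_def
    by (intro Bochner_Integration.integral_cong) (auto simp: indicator_def)
  finally show ?thesis .
qed

text \<open>By Fubini, the tail integral \<open>T\<close> of \<open>g\<close> has weak derivative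
  \<open>- g\<close>. So \<open>f + T\<close> has weak derivative zero, and the du Bois-Reymond
  lemma for its real and imaginary parts makes it constant; \<open>T b = 0\<close> identifies the
  constant as \<open>f b\<close>.\<close>

lemma weak_deriv_tail_integral:
  assumes ab: "a < b" and f: "continuous_on {a..b} f" and wd: "has_weak_deriv a b f g" and t: "t \<in> {a..b}"
  shows "f t = f b - (LBINT s:{t<..<b}. g s)"
proof -
  define T where "T t = (LBINT s:{t<..<b}. g s)" for t
  define h where "h t = f t + T t" for t
  have g: "set_integrable lborel {a<..<b} g"
    using wd by (simp add: has_weak_deriv_def square_integrable_imp_set_integrable)
  have T: "continuous_on {a..b} T"
    using continuous_on_tail_convolution[OF continuous_on_const[of UNIV 1] g] by (simp add: T_def[abs_def])
  have h: "continuous_on {a..b} h"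
    unfolding h_def by (intro continuous_intros f T)
  have orth: "(LBINT t:{a<..<b}. deriv \<phi> t *\<^sub>R h t) = 0" if \<phi>: "test_function a b \<phi>" for \<phi>
  proof -
    define \<psi> where "\<psi> t = complex_of_real (deriv \<phi> t)" for t
    from \<phi> obtain D S where D: "\<And>t. (\<phi> has_vector_derivative D t) (at t)" "continuous_on UNIV D"
      and S: "S \<subseteq> {a<..<b}" "\<And>t. t \<notin> S \<Longrightarrow> \<phi> t = 0"
      unfolding test_function_def C1_differentiable_on_def by auto
    have deriv: "deriv \<phi> = D"
      using D(1) by (intro ext DERIV_imp_deriv) (simp add: has_real_derivative_iff_has_vector_derivative)
    have \<psi>: "continuous_on A \<psi>" for A
      unfolding \<psi>_def deriv by (intro continuous_intros continuous_on_subset[OF D(2)]) auto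
    have \<phi>ab: "\<phi> a = 0" "\<phi> b = 0"
      using subsetD[OF S(1), of a] subsetD[OF S(1), of b] S(2)[of a] S(2)[of b] by auto
    have FTC: "(LBINT t:{s<..<b}. \<psi> t) = - complex_of_real (\<phi> s)" if "s \<le> b" for s
    proof -
      have "(LBINT t:{s<..<b}. \<psi> t) = complex_of_real (\<phi> b) - complex_of_real (\<phi> s)"
      proof (rule set_integral_FTC[OF that _ \<psi>])
        show "((\<lambda>t. complex_of_real (\<phi> t)) has_vector_derivative \<psi> t) (at t within {s..b})" for t
          unfolding \<psi>_def deriv using D(1)[of t]
          by (intro has_vector_derivative_at_within[OF has_vector_derivative_of_real])
            (simp add: has_real_derivative_iff_has_vector_derivative)
      qed
      then show ?thesis
        using \<phi>ab by simp
    qed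
    \<comment> \<open>Writing \<open>\<phi> s\<close> as minus the integral of its derivative from
      \<open>s\<close> to \<open>b\<close> exhibits the pairing with \<open>g\<close> as an integral
      over the triangle.\<close>
    have "(LBINT s:{a<..<b}. \<phi> s *\<^sub>R g s) = - (LBINT s:{a<..<b}. g s * (LBINT t:{s<..<b}. \<psi> t))"
    proof -
      have "(LBINT s:{a<..<b}. g s * (LBINT t:{s<..<b}. \<psi> t)) = (LBINT s:{a<..<b}. (-1) * (\<phi> s *\<^sub>R g s))"
        by (intro set_lebesgue_integral_cong) (auto simp: FTC scaleR_conv_of_real)
      also have "\<dots> = - (LBINT s:{a<..<b}. \<phi> s *\<^sub>R g s)"
        by (subst set_integral_mult_right) simp
      finally show ?thesis by simp
    qed
    also have "(LBINT s:{a<..<b}. g s * (LBINT t:{s<..<b}. \<psi> t)) = (LBINT t:{a<..<b}. (LBINT s:{a<..<t}. g s) * \<psi> t)"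
      by (intro triangle_Fubini_unit g set_integrable_open_of_continuous_on \<psi>)
    also have "\<dots> = (LBINT t:{a<..<b}. T a * \<psi> t - T t * \<psi> t)"
    proof (intro set_lebesgue_integral_cong allI impI)
      fix t assume "t \<in> {a<..<b}"
      then have "(LBINT s:{a<..<t}. g s) = T a - T t"
        using set_integral_split_point[OF g, of t] by (simp add: T_def)
      then show "(LBINT s:{a<..<t}. g s) * \<psi> t = T a * \<psi> t - T t * \<psi> t"
        by (simp only: left_diff_distrib)
    qed simp
    also have "\<dots> = (LBINT t:{a<..<b}. T a * \<psi> t) - (LBINT t:{a<..<b}. T t * \<psi> t)"
      by (intro set_integral_diff set_integrable_open_of_continuous_on continuous_intros T \<psi>)
    \<comment> \<open>The constant \<open>T a\<close> left by the splitting contributes nothing,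
      since the derivative of a test function has integral zero.\<close>
    also have "(LBINT t:{a<..<b}. T a * \<psi> t) = 0"
      using FTC[of a] ab \<phi>ab by simp
    finally have 1: "(LBINT s:{a<..<b}. \<phi> s *\<^sub>R g s) = (LBINT t:{a<..<b}. T t * \<psi> t)"
      by simp
    have "(LBINT t:{a<..<b}. deriv \<phi> t *\<^sub>R h t) = (LBINT t:{a<..<b}. f t * \<psi> t + T t * \<psi> t)"
      by (simp add: h_def \<psi>_def scaleR_conv_of_real algebra_simps)
    also have "\<dots> = (LBINT t:{a<..<b}. f t * \<psi> t) + (LBINT t:{a<..<b}. T t * \<psi> t)"
      by (intro set_integral_add set_integrable_open_of_continuous_on continuous_intros T \<psi> f)
    also have "(LBINT t:{a<..<b}. f t * \<psi> t) = - (LBINT s:{a<..<b}. \<phi> s *\<^sub>R g s)"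
    proof -
      have "(LBINT t:{a<..<b}. deriv \<phi> t *\<^sub>R f t) = - (LBINT s:{a<..<b}. \<phi> s *\<^sub>R g s)"
        using wd \<phi> unfolding has_weak_deriv_def by blast
      moreover have "deriv \<phi> t *\<^sub>R f t = f t * \<psi> t" for t
        by (simp add: \<psi>_def scaleR_conv_of_real)
      ultimately show ?thesis by simp
    qed
    finally show ?thesis
      using 1 by simp
  qed
  \<comment> \<open>Integrability is what lets real and imaginary parts be taken inside the
    integral.\<close>
  have \<psi>h: "set_integrable lborel {a<..<b} (\<lambda>t. deriv \<phi> t *\<^sub>R h t)" if \<phi>: "test_function a b \<phi>" for \<phi>
  proof -
    from \<phi> obtain D where D: "\<And>t. (\<phi> has_vector_derivative D t) (at t)" "continuous_on UNIV D"
      unfolding test_function_def C1_differentiable_on_def by auto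
    have "deriv \<phi> = D"
      using D(1) by (intro ext DERIV_imp_deriv) (simp add: has_real_derivative_iff_has_vector_derivative)
    then show ?thesis
      using D(2) by (intro set_integrable_open_of_continuous_on continuous_intros h)
        (auto intro: continuous_on_subset)
  qed
  have "Re (h t) = Re (h b)"
  proof (rule du_Bois_Reymond[OF ab _ _ t])
    show "continuous_on {a..b} (\<lambda>t. Re (h t))"
      by (intro continuous_intros h)
    show "(LBINT t:{a<..<b}. deriv \<phi> t * Re (h t)) = 0" if \<phi>: "test_function a b \<phi>" for \<phi>
      using integral_Re[OF \<psi>h[OF \<phi>, unfolded set_integrable_def]] orth[OF \<phi>]
      unfolding set_lebesgue_integral_def by (simp add: mult.assoc)
  qed
  moreover have "Im (h t) = Im (h b)"
  proof (rule du_Bois_Reymond[OF ab _ _ t])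
    show "continuous_on {a..b} (\<lambda>t. Im (h t))"
      by (intro continuous_intros h)
    show "(LBINT t:{a<..<b}. deriv \<phi> t * Im (h t)) = 0" if \<phi>: "test_function a b \<phi>" for \<phi>
      using integral_Im[OF \<psi>h[OF \<phi>, unfolded set_integrable_def]] orth[OF \<phi>]
      unfolding set_lebesgue_integral_def by (simp add: mult.assoc)
  qed
  ultimately have "h t = h b"
    by (rule complex_eqI)
  moreover have "T b = 0"
    by (simp add: T_def set_lebesgue_integral_def)
  ultimately show ?thesis
    by (simp add: h_def T_def algebra_simps)
qed

text \<open>Membership in \<open>H1\<close> provides some weak derivative, so the choice made by
  \<open>weak_deriv\<close> is one. Weak derivatives enter all later arguments through these two
  facts.\<close>

lemma H1_tail_integral:
  assumes "a < b" and "f \<in> H1 a b"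
  shows "set_integrable lborel {a<..<b} (weak_deriv a b f)"
    and "t \<in> {a..b} \<Longrightarrow> f t = f b - (LBINT s:{t<..<b}. weak_deriv a b f s)"
proof -
  have wd: "has_weak_deriv a b f (weak_deriv a b f)"
    using assms(2) someI_ex[of "has_weak_deriv a b f"] unfolding weak_deriv_def H1_def by blast
  show "set_integrable lborel {a<..<b} (weak_deriv a b f)"
    using wd by (simp add: has_weak_deriv_def square_integrable_imp_set_integrable)
  show "f t = f b - (LBINT s:{t<..<b}. weak_deriv a b f s)" if "t \<in> {a..b}"
    using weak_deriv_tail_integral[OF assms(1) _ wd that] assms(2) by (simp add: H1_def)
qed

section \<open>Differentiability of the right convolution and integration by parts\<close>

text \<open>This replaces differentiation under the integral sign, which would meet the derivative
  of the Mittag-Leffler kernel, singular at 0. Inserting the representation of \<open>x\<close> and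
  exchanging integrals twice moves the derivative onto \<open>x\<close>. The new integrand is
  continuous in \<open>s\<close>, so the convolution is continuously differentiable in
  \<open>t\<close>.\<close>

lemma convolution_eq_tail_integral:
  fixes K :: "real \<Rightarrow> real" and x g :: "real \<Rightarrow> complex"
  assumes K: "continuous_on UNIV K" and g: "set_integrable lborel {a<..<b} g"
    and x: "\<And>t. t \<in> {a..b} \<Longrightarrow> x t = x b - (LBINT s:{t<..<b}. g s)" and t: "t \<in> {a..b}"
  shows "(LBINT s:{t<..<b}. K (s - t) *\<^sub>R x s)
      = (LBINT s:{t<..<b}. K (b - s) *\<^sub>R x b - (LBINT v:{s<..<b}. K (v - s) *\<^sub>R g v))"
proof -
  have g': "set_integrable lborel {t<..<b} g"
    by (rule set_integrable_subset[OF g]) (use t in auto)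
  have KK: "continuous_on A (\<lambda>s. K (c s))" if "continuous_on A c" for c :: "real \<Rightarrow> real" and A
    using continuous_on_compose2[OF K that] by simp
  have tail: "continuous_on {t..b} (\<lambda>s. LBINT v:{s<..<b}. g v)"
    using continuous_on_tail_convolution[OF continuous_on_const[of UNIV 1] g'] by simp
  have const: "set_integrable lborel {t<..<b} (\<lambda>_. 1 :: complex)"
    by (intro set_integrable_open_of_continuous_on continuous_intros)
  have "(LBINT s:{t<..<b}. K (s - t) *\<^sub>R x s)
      = (LBINT s:{t<..<b}. K (s - t) *\<^sub>R x b - complex_of_real (K (s - t)) * (LBINT v:{s<..<b}. g v))"
  proof (intro set_lebesgue_integral_cong allI impI)
    fix s assume "s \<in> {t<..<b}"
    then show "K (s - t) *\<^sub>R x s = K (s - t) *\<^sub>R x b - complex_of_real (K (s - t)) * (LBINT v:{s<..<b}. g v)"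
      using t by (subst x) (auto simp: scaleR_conv_of_real algebra_simps)
  qed simp
  also have "\<dots> = (LBINT s:{t<..<b}. K (s - t) *\<^sub>R x b)
      - (LBINT s:{t<..<b}. complex_of_real (K (s - t)) * (LBINT v:{s<..<b}. g v))"
    by (intro set_integral_diff set_integrable_open_of_continuous_on continuous_intros KK tail)
  also have "(LBINT s:{t<..<b}. complex_of_real (K (s - t)) * (LBINT v:{s<..<b}. g v))
      = (LBINT v:{t<..<b}. (LBINT s:{t<..<v}. complex_of_real (K (s - t))) * g v)"
    by (intro triangle_Fubini_unit g' set_integrable_open_of_continuous_on continuous_intros KK)
  \<comment> \<open>Reflecting the inner integral replaces \<open>K (s - t)\<close> by
    \<open>K (v - s)\<close>, which is the kernel form of \<open>triangle_Fubini\<close>; that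
    lemma, read backwards with the constant 1 as first function, restores \<open>s\<close> as outer
    variable.\<close>
  also have "\<dots> = (LBINT v:{t<..<b}. (LBINT s:{t<..<v}. K (v - s) *\<^sub>R 1) * g v)"
    using set_integral_reflect[of t _ "\<lambda>s. complex_of_real (K (s - t))"] by (simp add: scaleR_conv_of_real)
  also have "\<dots> = (LBINT s:{t<..<b}. 1 * (LBINT v:{s<..<b}. K (v - s) *\<^sub>R g v))"
    by (rule triangle_Fubini[OF const g' K, symmetric])
  also have "(LBINT s:{t<..<b}. K (s - t) *\<^sub>R x b) = (LBINT s:{t<..<b}. K (b - s) *\<^sub>R x b)"
    using set_integral_reflect[of t b "\<lambda>s. K (s - t) *\<^sub>R x b"] by simp
  also have "(LBINT s:{t<..<b}. K (b - s) *\<^sub>R x b)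
        - (LBINT s:{t<..<b}. 1 * (LBINT v:{s<..<b}. K (v - s) *\<^sub>R g v))
      = (LBINT s:{t<..<b}. K (b - s) *\<^sub>R x b - (LBINT v:{s<..<b}. K (v - s) *\<^sub>R g v))"
    using continuous_on_tail_convolution[OF K g']
    by (subst set_integral_diff) (auto intro!: set_integrable_open_of_continuous_on continuous_intros KK)
  finally show ?thesis .
qed

text \<open>Here \<open>g\<close> plays the derivative of \<open>y\<close>, and \<open>J\<close>
  minus the derivative of the right convolution of \<open>x\<close>. One exchange of integrals moves
  \<open>K\<close> onto \<open>cnj (x t)\<close>, and a second one integrates \<open>g\<close> to
  \<open>y t - y a\<close>. There is no term at \<open>b\<close> because tail integrals vanish
  there.\<close>

lemma convolution_integration_by_parts:
  fixes K :: "real \<Rightarrow> real" and x g J y :: "real \<Rightarrow> complex"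
  assumes ab: "a < b" and K: "continuous_on UNIV K" and g: "set_integrable lborel {a<..<b} g"
    and x: "continuous_on {a..b} x" and J: "continuous_on {a..b} J" and yc: "continuous_on {a..b} y"
    and y: "\<And>t. t \<in> {a..b} \<Longrightarrow> y t = y b - (LBINT s:{t<..<b}. g s)"
    and xJ: "\<And>t. t \<in> {a..b} \<Longrightarrow> (LBINT s:{t<..<b}. K (s - t) *\<^sub>R x s) = (LBINT s:{t<..<b}. J s)"
  shows "(LBINT t:{a<..<b}. (LBINT s:{a<..<t}. K (t - s) *\<^sub>R g s) * cnj (x t))
      = (LBINT t:{a<..<b}. y t * cnj (J t)) - y a * cnj (LBINT s:{a<..<b}. K (s - a) *\<^sub>R x s)"
proof -
  have "(LBINT t:{a<..<b}. (LBINT s:{a<..<t}. K (t - s) *\<^sub>R g s) * cnj (x t))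
      = (LBINT s:{a<..<b}. g s * (LBINT t:{s<..<b}. K (t - s) *\<^sub>R cnj (x t)))"
    by (intro triangle_Fubini[symmetric] K g set_integrable_open_of_continuous_on continuous_intros x)
  also have "\<dots> = (LBINT s:{a<..<b}. g s * (LBINT t:{s<..<b}. cnj (J t)))"
    using xJ by (intro set_lebesgue_integral_cong) (auto simp: set_integral_cnj simp flip: complex_cnj_scaleR)
  also have "\<dots> = (LBINT t:{a<..<b}. (LBINT s:{a<..<t}. g s) * cnj (J t))"
    by (intro triangle_Fubini_unit g set_integrable_open_of_continuous_on continuous_intros J)
  also have "\<dots> = (LBINT t:{a<..<b}. y t * cnj (J t) - y a * cnj (J t))"
  proof (intro set_lebesgue_integral_cong allI impI)
    fix t assume "t \<in> {a<..<b}"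
    then have "(LBINT s:{a<..<t}. g s) = y t - y a"
      using set_integral_split_point[OF g, of t] y[of t] y[of a] by simp
    then show "(LBINT s:{a<..<t}. g s) * cnj (J t) = y t * cnj (J t) - y a * cnj (J t)"
      by (simp only: left_diff_distrib)
  qed simp
  also have "\<dots> = (LBINT t:{a<..<b}. y t * cnj (J t)) - (LBINT t:{a<..<b}. y a * cnj (J t))"
    by (intro set_integral_diff set_integrable_open_of_continuous_on continuous_intros J yc)
  also have "(LBINT t:{a<..<b}. y a * cnj (J t)) = y a * cnj (LBINT s:{a<..<b}. K (s - a) *\<^sub>R x s)"
    using xJ[of a] ab by (simp add: set_integral_cnj)
  finally show ?thesis .
qed

section \<open>The boundary term and the reality of the eigenvalue\<close>

text \<open>The imaginary part of \<open>w * cnj z\<close> is, up to sign, the determinant of the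
  real homogeneous system formed by the real and imaginary parts of the relation. It vanishes
  because \<open>(c1, c2)\<close> is a nonzero solution.\<close>

lemma mult_cnj_real_of_real_relation:
  fixes z w :: complex
  assumes "c1 *\<^sub>R z + c2 *\<^sub>R w = 0" and "c1\<^sup>2 + c2\<^sup>2 \<noteq> 0"
  shows "w * cnj z \<in> \<real>"
proof -
  have re: "c1 * Re z + c2 * Re w = 0" and im: "c1 * Im z + c2 * Im w = 0"
    using arg_cong[OF assms(1), of Re] arg_cong[OF assms(1), of Im] by simp_all
  \<comment> \<open>Cramer's rule, written as polynomial identities.\<close>
  have "c1 * Im (w * cnj z) = Im w * (c1 * Re z + c2 * Re w) - Re w * (c1 * Im z + c2 * Im w)"
    and "c2 * Im (w * cnj z) = Re z * (c1 * Im z + c2 * Im w) - Im z * (c1 * Re z + c2 * Re w)"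
    by (simp_all add: algebra_simps)
  then have "c1 * Im (w * cnj z) = 0" "c2 * Im (w * cnj z) = 0"
    unfolding re im by simp_all
  moreover have "c1 \<noteq> 0 \<or> c2 \<noteq> 0"
    using assms(2) by auto
  ultimately show ?thesis
    by (auto simp: complex_is_Real_iff)
qed

theorem theorem11:
  fixes a b \<alpha> c1 c2 d1 d2 :: real
    and B p q r :: "real \<Rightarrow> real"
    and lam :: complex
  assumes "a < b" and "0 < \<alpha>" and "\<alpha> < 1" and "0 < B \<alpha>"
    and "continuous_on {a..b} p" and "continuous_on {a..b} q" and "continuous_on {a..b} r"
    and "\<And>t. t \<in> {a..b} \<Longrightarrow> p t \<noteq> 0"
    and "\<And>t. t \<in> {a..b} \<Longrightarrow> 0 < r t"
    and "c1\<^sup>2 + c2\<^sup>2 \<noteq> 0" and "d1\<^sup>2 + d2\<^sup>2 \<noteq> 0"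
    and "SL_eigenvalue B \<alpha> a b p q r c1 c2 d1 d2 lam"
  shows "lam \<in> \<real>"
proof -
  define w where "w = - \<alpha> / (1 - \<alpha>)"
  define c where "c = B \<alpha> / (1 - \<alpha>)"
  define K where "K u = mittag_leffler \<alpha> (w * max u 0 powr \<alpha>)" for u :: real
  note ab = \<open>a < b\<close>
  obtain x t0 where sol: "SL_solution B \<alpha> a b p q r c1 c2 d1 d2 lam x" and t0: "t0 \<in> {a..b}" "x t0 \<noteq> 0"
    using assms(12) unfolding SL_eigenvalue_def by blast
  define X where "X = mittag_leffler_integral_right \<alpha> w b x"
  define y where "y t = p t *\<^sub>R ABR_right B \<alpha> a b x t" for t
  have xH: "x \<in> H1 a b" and yH: "y \<in> H1 a b"
    and eq: "\<And>t. t \<in> {a<..<b} \<Longrightarrow> ABC_left B \<alpha> a b y t + q t *\<^sub>R x t = lam * (r t *\<^sub>R x t)"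
    and bc: "c1 *\<^sub>R X a + c2 *\<^sub>R ABR_right B \<alpha> a b x a = 0"
    using sol unfolding SL_solution_def y_def[abs_def] X_def w_def by auto
  have xc: "continuous_on {a..b} x" and yc: "continuous_on {a..b} y"
    using xH yH by (auto simp: H1_def)
  have K: "continuous_on UNIV K"
    unfolding K_def using assms(2) by (rule continuous_on_mittag_leffler_kernel)
  have X_eq: "X t = (LBINT s:{t<..<b}. K (s - t) *\<^sub>R x s)" if "t \<in> {a..b}" for t
  proof -
    have "X t = (LBINT s:{t<..<b}. mittag_leffler \<alpha> (w * (s - t) powr \<alpha>) *\<^sub>R x s)"
      using that unfolding X_def mittag_leffler_integral_right_def by (simp add: interval_lebesgue_integral_le_eq)
    also have "\<dots> = (LBINT s:{t<..<b}. K (s - t) *\<^sub>R x s)"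
      by (intro set_lebesgue_integral_cong) (auto simp: K_def)
    finally show ?thesis .
  qed
  define g where "g = weak_deriv a b x"
  note g = H1_tail_integral[OF ab xH, folded g_def]
  \<comment> \<open>\<open>J\<close> is minus the derivative of \<open>X\<close>. The two minus
    signs cancel in \<open>ABR_right\<close>, which becomes \<open>c *\<^sub>R J t\<close> on all of
    \<open>{a..b}\<close>, endpoints included.\<close>
  define J where "J t = K (b - t) *\<^sub>R x b - (LBINT v:{t<..<b}. K (v - t) *\<^sub>R g v)" for t
  have J: "continuous_on {a..b} J"
    unfolding J_def
    by (intro continuous_intros continuous_on_tail_convolution K g(1) continuous_on_compose2[OF K]) auto
  have xJ: "(LBINT s:{t<..<b}. K (s - t) *\<^sub>R x s) = (LBINT s:{t<..<b}. J s)" if "t \<in> {a..b}" for t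
    using convolution_eq_tail_integral[OF K g that] unfolding J_def .
  have R: "ABR_right B \<alpha> a b x t = c *\<^sub>R J t" if "t \<in> {a..b}" for t
  proof -
    have "(X has_vector_derivative - J t) (at t within {a..b})"
      using that X_eq xJ
      by (intro has_vector_derivative_transform[OF that _ tail_integral_has_vector_derivative[OF J that]]) simp
    then have "vector_derivative X (at t within {a..b}) = - J t"
      using ab that by (intro vector_derivative_within_closed_interval)
    then show ?thesis
      unfolding ABR_right_def X_def w_def c_def by simp
  qed
  have y_eq: "y t = (p t * c) *\<^sub>R J t" if "t \<in> {a..b}" for t
    using R[OF that] by (simp add: y_def)
  define h where "h = weak_deriv a b y"
  note h = H1_tail_integral[OF ab yH, folded h_def]
  have ABC: "ABC_left B \<alpha> a b y t = c *\<^sub>R (LBINT s:{a<..<t}. K (t - s) *\<^sub>R h s)" if "t \<in> {a<..<b}" for t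
  proof -
    have "ABC_left B \<alpha> a b y t = c *\<^sub>R (LBINT s:{a<..<t}. mittag_leffler \<alpha> (w * (t - s) powr \<alpha>) *\<^sub>R h s)"
      using that unfolding ABC_left_def c_def w_def h_def by (simp add: interval_lebesgue_integral_le_eq)
    also have "(LBINT s:{a<..<t}. mittag_leffler \<alpha> (w * (t - s) powr \<alpha>) *\<^sub>R h s) = (LBINT s:{a<..<t}. K (t - s) *\<^sub>R h s)"
      by (intro set_lebesgue_integral_cong) (auto simp: K_def)
    finally show ?thesis .
  qed
  define P Q I where "P = (LBINT t:{a<..<b}. p t * c * (norm (J t))\<^sup>2)"
    and "Q = (LBINT t:{a<..<b}. q t * (norm (x t))\<^sup>2)"
    and "I = (LBINT t:{a<..<b}. r t * (norm (x t))\<^sup>2)"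
  have sq: "z * cnj z = complex_of_real ((norm z)\<^sup>2)" for z
    by (rule complex_norm_square[symmetric])
  \<comment> \<open>The pairing of the Caputo derivative of \<open>y\<close> with \<open>x\<close>
    is computed twice: here by integration by parts, then in \<open>rhs\<close> from the
    differential equation. In the first result \<open>y\<close> is a real multiple of
    \<open>J\<close>, so the integral part \<open>P\<close> is real.\<close>
  have "(LBINT t:{a<..<b}. ABC_left B \<alpha> a b y t * cnj (x t))
      = (LBINT t:{a<..<b}. complex_of_real c * ((LBINT s:{a<..<t}. K (t - s) *\<^sub>R h s) * cnj (x t)))"
    using ABC by (intro set_lebesgue_integral_cong) (auto simp: scaleR_conv_of_real)
  also have "\<dots> = complex_of_real c * ((LBINT t:{a<..<b}. y t * cnj (J t)) - y a * cnj (X a))"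
    using convolution_integration_by_parts[OF ab K h(1) xc J yc h(2) xJ] X_eq[of a] ab
    by (subst set_integral_mult_right) simp
  also have "(LBINT t:{a<..<b}. y t * cnj (J t)) = (LBINT t:{a<..<b}. complex_of_real (p t * c * (norm (J t))\<^sup>2))"
  proof (intro set_lebesgue_integral_cong allI impI)
    fix t assume "t \<in> {a<..<b}"
    then have "y t = complex_of_real (p t * c) * J t"
      using y_eq[of t] by (simp add: scaleR_conv_of_real)
    then show "y t * cnj (J t) = complex_of_real (p t * c * (norm (J t))\<^sup>2)"
      using sq[of "J t"] by (simp only: of_real_mult mult.assoc)
  qed simp
  also have "\<dots> = complex_of_real P"
    unfolding P_def by (rule set_integral_complex_of_real)
  finally have lhs: "(LBINT t:{a<..<b}. ABC_left B \<alpha> a b y t * cnj (x t))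
      = complex_of_real c * (complex_of_real P - y a * cnj (X a))" .
  have "(LBINT t:{a<..<b}. ABC_left B \<alpha> a b y t * cnj (x t))
      = (LBINT t:{a<..<b}. lam * complex_of_real (r t * (norm (x t))\<^sup>2) - complex_of_real (q t * (norm (x t))\<^sup>2))"
  proof (intro set_lebesgue_integral_cong allI impI)
    fix t assume "t \<in> {a<..<b}"
    then have "ABC_left B \<alpha> a b y t = lam * (r t *\<^sub>R x t) - q t *\<^sub>R x t"
      using eq[of t] by (simp add: eq_diff_eq)
    then show "ABC_left B \<alpha> a b y t * cnj (x t)
        = lam * complex_of_real (r t * (norm (x t))\<^sup>2) - complex_of_real (q t * (norm (x t))\<^sup>2)"
      unfolding of_real_mult sq[symmetric] by (simp only:) (simp add: scaleR_conv_of_real algebra_simps)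
  qed simp
  also have "\<dots> = (LBINT t:{a<..<b}. lam * complex_of_real (r t * (norm (x t))\<^sup>2))
      - (LBINT t:{a<..<b}. complex_of_real (q t * (norm (x t))\<^sup>2))"
    by (intro set_integral_diff set_integrable_open_of_continuous_on continuous_intros xc assms(6,7))
  also have "\<dots> = lam * complex_of_real I - complex_of_real Q"
    unfolding I_def Q_def by (simp only: set_integral_mult_right set_integral_complex_of_real)
  finally have rhs: "(LBINT t:{a<..<b}. ABC_left B \<alpha> a b y t * cnj (x t))
      = lam * complex_of_real I - complex_of_real Q" .
  have rc: "continuous_on {a..b} (\<lambda>t. r t * (norm (x t))\<^sup>2)"
    by (intro continuous_intros xc assms(7))
  \<comment> \<open>The integrand is continuous and nonnegative on \<open>{a..b}\<close>, so a zero
    integral would make it vanish everywhere, also if \<open>t0\<close> is an endpoint.\<close>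
  have "I \<noteq> 0"
  proof
    assume "I = 0"
    then have "integral {a..b} (\<lambda>t. r t * (norm (x t))\<^sup>2) = 0"
      using set_integral_open_eq_integral[OF _ rc] ab by (simp add: I_def)
    then have "r t0 * (norm (x t0))\<^sup>2 = 0"
      using integral_eq_0_iff[OF rc ab] assms(9) t0(1) by (simp add: less_imp_le)
    then show False
      using assms(9)[OF t0(1)] t0(2) by simp
  qed
  \<comment> \<open>The factor \<open>p a\<close> is real, and the boundary condition at
    \<open>a\<close> is a nontrivial real relation between \<open>X a\<close> and the derivative of
    \<open>x\<close>.\<close>
  have "y a * cnj (X a) = complex_of_real (p a) * (ABR_right B \<alpha> a b x a * cnj (X a))"
    by (simp add: y_def scaleR_conv_of_real)
  also have "\<dots> \<in> \<real>"
    using mult_cnj_real_of_real_relation[OF bc assms(10)] by (rule Reals_mult[OF Reals_of_real])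
  finally have "complex_of_real c * (complex_of_real P - y a * cnj (X a)) + complex_of_real Q \<in> \<real>"
    by (rule Reals_add[OF Reals_mult[OF Reals_of_real Reals_diff[OF Reals_of_real]] Reals_of_real])
  also have "complex_of_real c * (complex_of_real P - y a * cnj (X a)) + complex_of_real Q = lam * complex_of_real I"
    unfolding lhs[symmetric] rhs by simp
  finally have "lam * complex_of_real I / complex_of_real I \<in> \<real>"
    by (rule Reals_divide[OF _ Reals_of_real])
  then show ?thesis
    using \<open>I \<noteq> 0\<close> by simp
qed

end
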